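(* Let $D$ be a digraph without useless arcs and let $k\geq 1$ be an integer. If $\ell(D)\geq 3k$, then $\ell_s(D)\geq k$, i.e. $D$ has an out-branching with at least $k$ leaves.
   Context: An out-tree of a digraph $D$ is a subgraph of $D$ that is a tree (ignoring arc directions) in which exactly one vertex, the root, has in-degree $0$ and every other vertex has in-degree $1$. An out-branching is a spanning out-tree. A leaf is a vertex of out-degree $0$ in the out-tree. $\ell(D)$ and $\ell_s(D)$ denote the maximum number of leaves over all out-trees and over all out-branchings of $D$, respectively. An arc of $D$ is useless if no out-branching of $D$ contains it. *)

theory Defs
  imports Main
begin

text \<open>A (finite) digraph D is given by a finite vertex set V and an arc set A \<subseteq> V \<times> V.\<close>

definition digraph :: "'a set \<Rightarrow> ('a \<times> 'a) set \<Rightarrow> bool" where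
  "digraph V A \<longleftrightarrow> finite V \<and> V \<noteq> {} \<and> A \<subseteq> V \<times> V"

definition in_deg :: "('a \<times> 'a) set \<Rightarrow> 'a \<Rightarrow> nat" where
  "in_deg A v = card {u. (u, v) \<in> A}"

definition out_deg :: "('a \<times> 'a) set \<Rightarrow> 'a \<Rightarrow> nat" where
  "out_deg A v = card {w. (v, w) \<in> A}"

text \<open>Underlying undirected graph of (V', A') is a tree: finite, nonempty, connected
  (ignoring arc directions), with exactly |V'| - 1 arcs.\<close>
definition is_tree :: "'a set \<Rightarrow> ('a \<times> 'a) set \<Rightarrow> bool" where
  "is_tree V' A' \<longleftrightarrow> finite V' \<and> V' \<noteq> {} \<and> A' \<subseteq> V' \<times> V' \<and>
     (\<forall>u\<in>V'. \<forall>v\<in>V'. (u, v) \<in> (A' \<union> A'\<inverse>)\<^sup>*) \<and> card A' + 1 = card V'"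

text \<open>Out-tree of D = (V, A): a subgraph (V', A') which is a tree in which exactly one vertex
  (the root) has in-degree 0 and every other vertex has in-degree 1.\<close>
definition out_tree :: "'a set \<Rightarrow> ('a \<times> 'a) set \<Rightarrow> 'a set \<Rightarrow> ('a \<times> 'a) set \<Rightarrow> bool" where
  "out_tree V A V' A' \<longleftrightarrow> V' \<subseteq> V \<and> A' \<subseteq> A \<and> is_tree V' A' \<and>
     (\<exists>r\<in>V'. in_deg A' r = 0 \<and> (\<forall>v\<in>V' - {r}. in_deg A' v = 1))"

text \<open>Out-branching: spanning out-tree.\<close>
definition out_branching :: "'a set \<Rightarrow> ('a \<times> 'a) set \<Rightarrow> ('a \<times> 'a) set \<Rightarrow> bool" where
  "out_branching V A A' \<longleftrightarrow> out_tree V A V A'"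

definition leaves :: "'a set \<Rightarrow> ('a \<times> 'a) set \<Rightarrow> 'a set" where
  "leaves V' A' = {v \<in> V'. out_deg A' v = 0}"

definition useless_arc :: "'a set \<Rightarrow> ('a \<times> 'a) set \<Rightarrow> 'a \<times> 'a \<Rightarrow> bool" where
  "useless_arc V A a \<longleftrightarrow> a \<in> A \<and> \<not> (\<exists>A'. out_branching V A A' \<and> a \<in> A')"

text \<open>\<ell>(D) and \<ell>_s(D): maximum number of leaves over out-trees / out-branchings.\<close>
definition ell :: "'a set \<Rightarrow> ('a \<times> 'a) set \<Rightarrow> nat" where
  "ell V A = Max {card (leaves V' A') | V' A'. out_tree V A V' A'}"

definition ell_s :: "'a set \<Rightarrow> ('a \<times> 'a) set \<Rightarrow> nat" where
  "ell_s V A = Max {card (leaves V A') | A'. out_branching V A A'}"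

end

theory Submission
  imports Defs
begin

text \<open>Let L be the leaf set of an out-tree T with root t. Any set S of vertices that can be reached
  from the root s using only arcs with tail outside S becomes a set of leaves of some out-branching.
  If t is reachable from s with tails outside k leaves of T, these leaves work. Otherwise so many
  leaves are needed to separate t from s one after another that at least |L| - 2k + 2 of them are
  dominators of t. Since no arc is useless, the tree path from t back to such a dominator v enters
  the region not dominated by v through a vertex b that can be bypassed on the way from s to v.
  These vertices b, one for each dominator except possibly for s and the first of the others,
  are the desired leaves. For s we take the last vertex on the way to t that reaches all of V.\<close>

section \<open>Reachability with blocked vertices, and dominators\<close>

text \<open>Vertices of \<open>S\<close> may be entered but not left. So if \<open>t\<close> is
  reachable from \<open>r\<close> at all, \<open>t \<notin> reach A r {v}\<close> says that
  \<open>v\<close> is a dominator of \<open>t\<close> other than \<open>t\<close> itself.\<close>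

definition reach :: "('a \<times> 'a) set \<Rightarrow> 'a \<Rightarrow> 'a set \<Rightarrow> 'a set" where
  "reach A r S = {x. (r, x) \<in> {(a, b). (a, b) \<in> A \<and> a \<notin> S}\<^sup>*}"

lemma reach_root: "r \<in> reach A r S"
  by (simp add: reach_def)

lemma reach_step: "x \<in> reach A r S \<Longrightarrow> x \<notin> S \<Longrightarrow> (x, y) \<in> A \<Longrightarrow> y \<in> reach A r S"
  unfolding reach_def by (auto intro: rtrancl_into_rtrancl)

lemma reach_induct [consumes 1, case_names root step]:
  assumes "x \<in> reach A r S" "P r"
    and "\<And>x y. x \<in> reach A r S \<Longrightarrow> x \<notin> S \<Longrightarrow> (x, y) \<in> A \<Longrightarrow> P x \<Longrightarrow> P y"
  shows "P x"
proof -
  have "(r, x) \<in> {(a, b). (a, b) \<in> A \<and> a \<notin> S}\<^sup>*"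
    using assms(1) by (simp add: reach_def)
  then show ?thesis
    by (induction rule: rtrancl_induct) (auto intro: assms(2) assms(3) simp: reach_def)
qed

lemma reach_mono: "A \<subseteq> A' \<Longrightarrow> S' \<subseteq> S \<Longrightarrow> reach A r S \<subseteq> reach A' r S'"
  unfolding reach_def by (auto elim!: rtrancl_mono[THEN subsetD, rotated])

lemma reach_empty: "reach A r {} = A\<^sup>* `` {r}"
  by (auto simp: reach_def)

lemma reach_trans: "y \<in> reach A x S \<Longrightarrow> x \<in> reach A r S \<Longrightarrow> y \<in> reach A r S"
  unfolding reach_def by (auto intro: rtrancl_trans)

text \<open>A walk to \<open>x\<close> can be cut off at its first visit to
  \<open>x\<close>.\<close>

lemma reach_insert_self:
  assumes "x \<in> reach A r S"
  shows "x \<in> reach A r (insert x S)"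
proof -
  have "y \<in> reach A r (insert x S) \<or> x \<in> reach A r (insert x S)" if "y \<in> reach A r S" for y
    using that by (induction rule: reach_induct) (auto intro: reach_root reach_step)
  from this[OF assms] show ?thesis by blast
qed

text \<open>Walks that never leave \<open>v\<close> do not meet \<open>w\<close> at all, so blocking
  \<open>w\<close> does not harm them.\<close>

lemma reach_avoiding_subset:
  assumes "w \<notin> reach A r {v}"
  shows "reach A r {v} \<subseteq> reach A r {w}"
proof
  fix x assume "x \<in> reach A r {v}"
  then show "x \<in> reach A r {w}"
    by (induction rule: reach_induct) (use assms in \<open>auto intro: reach_root reach_step\<close>)
qed

text \<open>If each of \<open>v\<close> and \<open>w\<close> were reachable without leaving the
  other, then a walk arriving at either of them could go on with only the other one blocked, and one
  of the two blocks would fail to keep \<open>t\<close> out.\<close>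

lemma dominators_linear:
  assumes "v \<noteq> w" "t \<in> reach A r {}" "t \<notin> reach A r {v}" "t \<notin> reach A r {w}"
  shows "v \<notin> reach A r {w} \<or> w \<notin> reach A r {v}"
proof (rule ccontr)
  assume c: "\<not> ?thesis"
  have "t \<in> reach A r {v} \<union> reach A r {w}"
    using assms(2)
  proof (induction rule: reach_induct)
    case (step x y)
    then show ?case using c assms(1) by (cases "x = v"; cases "x = w") (auto intro: reach_step)
  qed (simp add: reach_root)
  then show False using assms by blast
qed

lemma rtrancl_crossing:
  assumes "(x, y) \<in> R\<^sup>*" "x \<notin> P" "y \<in> P"
  obtains a b where "(x, a) \<in> R\<^sup>*" "(a, b) \<in> R" "(b, y) \<in> R\<^sup>*" "a \<notin> P" "b \<in> P"
proof -
  have "\<exists>a b. (x, a) \<in> R\<^sup>* \<and> (a, b) \<in> R \<and> (b, y) \<in> R\<^sup>* \<and> a \<notin> P \<and> b \<in> P"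
    using assms
  proof (induction rule: rtrancl_induct)
    case (step y z)
    then show ?case by (cases "y \<in> P") (blast intro: rtrancl_into_rtrancl)+
  qed simp
  with that show ?thesis by blast
qed

section \<open>Rooted trees and their growth to out-branchings\<close>

text \<open>The directed form of an out-tree, suited to adding one arc at a time: paths from the
  root replace undirected connectivity and the arc count.\<close>

definition rooted_tree :: "'a \<Rightarrow> 'a set \<Rightarrow> ('a \<times> 'a) set \<Rightarrow> bool" where
  "rooted_tree r W B \<longleftrightarrow> finite W \<and> r \<in> W \<and> B \<subseteq> W \<times> W \<and> (\<forall>v\<in>W. (r, v) \<in> B\<^sup>*) \<and>
     (\<forall>u. (u, r) \<notin> B) \<and> (\<forall>u u' v. (u, v) \<in> B \<longrightarrow> (u', v) \<in> B \<longrightarrow> u = u')"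

lemma rooted_treeD:
  assumes "rooted_tree r W B"
  shows "finite W" "r \<in> W" "B \<subseteq> W \<times> W" "\<And>v. v \<in> W \<Longrightarrow> (r, v) \<in> B\<^sup>*"
    "\<And>u. (u, r) \<notin> B" "\<And>u u' v. (u, v) \<in> B \<Longrightarrow> (u', v) \<in> B \<Longrightarrow> u = u'"
  using assms unfolding rooted_tree_def by blast+

lemma rooted_tree_parent:
  assumes "rooted_tree r W B" "v \<in> W" "v \<noteq> r"
  obtains u where "(u, v) \<in> B" "(r, u) \<in> B\<^sup>*"
  using rooted_treeD(4)[OF assms(1,2)] assms(3) by (auto elim: rtranclE)

lemma out_tree_imp_rooted_tree:
  assumes "out_tree V A W B"
  obtains r where "rooted_tree r W B"
proof -
  have tree: "finite W" "B \<subseteq> W \<times> W" "\<And>u v. u \<in> W \<Longrightarrow> v \<in> W \<Longrightarrow> (u, v) \<in> (B \<union> B\<inverse>)\<^sup>*"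
    using assms unfolding out_tree_def is_tree_def by blast+
  obtain r where r: "r \<in> W" "in_deg B r = 0" "\<And>v. v \<in> W \<Longrightarrow> v \<noteq> r \<Longrightarrow> in_deg B v = 1"
    using assms unfolding out_tree_def by blast
  have fin: "finite {u. (u, v) \<in> B}" for v
    by (rule finite_subset[OF _ tree(1)]) (use tree(2) in auto)
  have noin: "(u, r) \<notin> B" for u
    using r(2) fin unfolding in_deg_def by auto
  have uniq: "u = u'" if "(u, v) \<in> B" "(u', v) \<in> B" for u u' v
  proof -
    have "v \<in> W" "v \<noteq> r" using that tree(2) noin by auto
    then have "card {u. (u, v) \<in> B} = 1" using r(3) by (simp add: in_deg_def)
    then obtain c where "{u. (u, v) \<in> B} = {c}" by (auto simp: card_1_singleton_iff)
    then show ?thesis using that by (metis mem_Collect_eq singletonD)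
  qed
  have "(r, v) \<in> B\<^sup>*" if "v \<in> W" for v
  proof -
    from tree(3)[OF r(1) that] show ?thesis
    proof (induction rule: rtrancl_induct)
      case (step y z)
      show ?case
      proof (cases "(y, z) \<in> B")
        case True
        then show ?thesis using step.IH by simp
      next
        case False
        \<comment> \<open>The arc from \<open>z\<close> shows that \<open>y\<close> is not the root
          and is the only arc into \<open>y\<close>. Hence the directed path from \<open>r\<close>
          to \<open>y\<close> comes through \<open>z\<close>.\<close>
        then have "(z, y) \<in> B" using step.hyps by blast
        with step.IH show ?thesis
          by (metis noin rtranclE uniq)
      qed
    qed simp
  qed
  then have "rooted_tree r W B"
    unfolding rooted_tree_def using tree r noin uniq by blast
  then show ?thesis by (rule that)
qed

lemma rooted_tree_imp_out_tree:
  assumes T: "rooted_tree r W B" and "W \<subseteq> V" "B \<subseteq> A"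
  shows "out_tree V A W B"
proof -
  note D = rooted_treeD[OF T]
  have deg: "in_deg B v = 1" if "v \<in> W" "v \<noteq> r" for v
  proof -
    obtain u where "(u, v) \<in> B" using rooted_tree_parent[OF T \<open>v \<in> W\<close> \<open>v \<noteq> r\<close>] .
    then have "{u. (u, v) \<in> B} = {u}" using D(6) by blast
    then show ?thesis by (simp add: in_deg_def)
  qed
  have deg0: "in_deg B r = 0" using D(5) by (simp add: in_deg_def)
  have "(u, v) \<in> (B \<union> B\<inverse>)\<^sup>*" if "u \<in> W" "v \<in> W" for u v
  proof -
    have "(u, r) \<in> (B\<inverse>)\<^sup>*" "(r, v) \<in> B\<^sup>*"
      using D(4) that by (auto intro: rtrancl_converseI)
    then have "(u, r) \<in> (B \<union> B\<inverse>)\<^sup>*" "(r, v) \<in> (B \<union> B\<inverse>)\<^sup>*"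
      by (meson in_rtrancl_UnI)+
    then show ?thesis by (rule rtrancl_trans)
  qed
  moreover have "card B + 1 = card W"
  proof -
    \<comment> \<open>Arcs are counted by their heads, which are all vertices except the
      root.\<close>
    have "inj_on snd B" using D(6) by (auto simp: inj_on_def)
    moreover have "snd ` B = W - {r}"
    proof
      show "W - {r} \<subseteq> snd ` B"
      proof
        fix v assume "v \<in> W - {r}"
        then obtain u where "(u, v) \<in> B" using rooted_tree_parent[OF T, of v] by auto
        then show "v \<in> snd ` B" by force
      qed
    qed (use D(3,5) in auto)
    ultimately have "card B = card (W - {r})" by (metis card_image)
    then show ?thesis using D(1,2) by (metis Suc_eq_plus1 card_Suc_Diff1)
  qed
  ultimately have "is_tree W B" unfolding is_tree_def using D(1,2,3) by blast
  then show ?thesis unfolding out_tree_def using assms(2,3) D(2) deg deg0 by blast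
qed

lemma leaves_eq:
  assumes "finite W" "B \<subseteq> W \<times> W"
  shows "leaves W B = {v \<in> W. \<forall>w. (v, w) \<notin> B}"
proof -
  have "finite {w. (v, w) \<in> B}" for v
    by (rule finite_subset[OF _ assms(1)]) (use assms(2) in auto)
  then show ?thesis by (auto simp: leaves_def out_deg_def)
qed

text \<open>At most \<open>x\<close> stops being a leaf, and \<open>y\<close> becomes one.\<close>

lemma rooted_tree_insert:
  assumes T: "rooted_tree r W B" and "x \<in> W" "y \<notin> W"
  shows "rooted_tree r (insert y W) (insert (x, y) B)"
    and "card (leaves W B) \<le> card (leaves (insert y W) (insert (x, y) B))"
proof -
  note D = rooted_treeD[OF T]
  have "(r, v) \<in> (insert (x, y) B)\<^sup>*" if "v \<in> insert y W" for v
  proof -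
    have *: "(r, v) \<in> (insert (x, y) B)\<^sup>*" if "v \<in> W" for v
      using D(4)[OF that] by (rule rtrancl_mono[THEN subsetD, rotated]) auto
    show ?thesis
      using that *[OF \<open>x \<in> W\<close>] * by (auto intro: rtrancl_into_rtrancl)
  qed
  moreover have "(u, y) \<notin> B" for u using D(3) assms(3) by auto
  moreover have "y \<noteq> r" using D(2) assms(3) by blast
  ultimately show T': "rooted_tree r (insert y W) (insert (x, y) B)"
    unfolding rooted_tree_def using D(1,2,3,5,6) assms(2) by (auto; metis)
  note D' = rooted_treeD[OF T']
  have "insert y (leaves W B - {x}) \<subseteq> leaves (insert y W) (insert (x, y) B)"
    unfolding leaves_eq[OF D(1,3)] leaves_eq[OF D'(1,3)] using D(3) assms(2,3) by auto
  moreover have fin: "finite (leaves W B)" "finite (leaves (insert y W) (insert (x, y) B))"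
    using D(1) by (auto simp: leaves_def)
  moreover have "y \<notin> leaves W B" using assms(3) by (simp add: leaves_def)
  then have "card (leaves W B) \<le> card (insert y (leaves W B - {x}))"
    using fin(1) by (simp add: card_Diff_singleton_if) arith
  ultimately show "card (leaves W B) \<le> card (leaves (insert y W) (insert (x, y) B))"
    by (meson card_mono le_trans)
qed

text \<open>Pendant arcs of \<open>F\<close> are added greedily until none leads out of the tree.
  The resulting closure under \<open>F\<close> later shows that the tree contains everything
  reachable from its root.\<close>

lemma rooted_tree_extend:
  assumes "finite V" "F \<subseteq> V \<times> V" "rooted_tree r W B" "W \<subseteq> V"
  shows "\<exists>W' B'. rooted_tree r W' B' \<and> W' \<subseteq> V \<and> B' \<subseteq> B \<union> F \<and> F `` W' \<subseteq> W' \<and>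
    card (leaves W B) \<le> card (leaves W' B')"
  using assms(3,4)
proof (induction "card (V - W)" arbitrary: W B rule: less_induct)
  case less
  show ?case
  proof (cases "F `` W \<subseteq> W")
    case True
    then show ?thesis using less.prems by blast
  next
    case False
    then obtain x y where xy: "x \<in> W" "(x, y) \<in> F" "y \<notin> W" by blast
    note ins = rooted_tree_insert[OF less.prems(1) xy(1,3)]
    have "y \<in> V" using xy assms(2) by auto
    then have "card (V - insert y W) < card (V - W)"
      using xy assms(1) by (intro psubset_card_mono) auto
    from less.hyps[OF this ins(1)] \<open>y \<in> V\<close> less.prems(2)
    obtain W' B' where "rooted_tree r W' B'" "W' \<subseteq> V" "B' \<subseteq> insert (x, y) B \<union> F"
      "F `` W' \<subseteq> W'" "card (leaves (insert y W) (insert (x, y) B)) \<le> card (leaves W' B')"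
      by auto
    then show ?thesis using ins(2) xy(2)
      by (intro exI[of _ W'] exI[of _ B']) auto
  qed
qed

text \<open>The tree grows in two phases. With only the arcs whose tail is outside \<open>S\<close>,
  it picks up all of \<open>S\<close> as leaves; then all arcs are allowed, and growth to a spanning
  tree never lowers the number of leaves.\<close>

lemma out_branching_with_leaves:
  assumes "finite V" "A \<subseteq> V \<times> V" "r \<in> V" "V \<subseteq> reach A r {}" "r \<notin> S" "S \<subseteq> reach A r S"
  shows "\<exists>B. out_branching V A B \<and> card S \<le> card (leaves V B)"
proof -
  define F where "F = {(a, b). (a, b) \<in> A \<and> a \<notin> S}"
  have F: "F \<subseteq> V \<times> V" "F \<subseteq> A" using assms(2) by (auto simp: F_def)
  have "rooted_tree r {r} {}" by (simp add: rooted_tree_def)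
  from rooted_tree_extend[OF assms(1) F(1) this] assms(3)
  obtain W B where W: "rooted_tree r W B" "W \<subseteq> V" "B \<subseteq> F" "F `` W \<subseteq> W" by auto
  note D = rooted_treeD[OF W(1)]
  have "x \<in> W" if "x \<in> reach A r S" for x
    using that by (induction rule: reach_induct) (use D(2) W(4) in \<open>auto simp: F_def\<close>)
  then have "S \<subseteq> leaves W B"
    unfolding leaves_eq[OF D(1,3)] using assms(6) W(3) by (auto simp: F_def)
  then have card: "card S \<le> card (leaves W B)"
    using D(1) by (intro card_mono) (auto simp: leaves_def)
  from rooted_tree_extend[OF assms(1,2) W(1,2)]
  obtain W' B' where W': "rooted_tree r W' B'" "W' \<subseteq> V" "B' \<subseteq> B \<union> A" "A `` W' \<subseteq> W'"
    "card (leaves W B) \<le> card (leaves W' B')" by blast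
  have "x \<in> W'" if "x \<in> reach A r {}" for x
    using that by (induction rule: reach_induct) (use rooted_treeD(2)[OF W'(1)] W'(4) in auto)
  then have "W' = V" using W'(2) assms(4) by blast
  moreover have "B' \<subseteq> A" using W'(3) W(3) F(2) by blast
  ultimately have "out_branching V A B'"
    unfolding out_branching_def using rooted_tree_imp_out_tree[OF W'(1)] by blast
  then show ?thesis using W'(5) card \<open>W' = V\<close> by force
qed

section \<open>Dominators among the leaves, and vertices that bypass them\<close>

text \<open>If every walk from s to t loses more than |L| - k points of L, sort L by the least number of
  points of L passed on the way: each level separates s from t, and there are too many levels
  for all of them to have two elements. A level of size one is a dominator of t.\<close>

lemma card_dominators:
  assumes "finite L" "k \<le> card L" "t \<in> reach A s {}"
    and sep: "\<And>S. S \<subseteq> L \<Longrightarrow> k \<le> card S \<Longrightarrow> t \<notin> reach A s S"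
  shows "card L + 2 \<le> card {v \<in> L. t \<notin> reach A s {v}} + 2 * k"
proof -
  define n where "n = card L - k"
  \<comment> \<open>\<open>R i\<close> is reached by leaving at most \<open>i\<close> points of
    \<open>L\<close>, collected in \<open>H\<close>; \<open>Y i\<close> is the level of points of
    \<open>L\<close> for which \<open>i\<close> is the least such number.\<close>
  define R where "R i = {x. \<exists>H\<subseteq>L. card H \<le> i \<and> x \<in> reach A s (L - H)}" for i
  define Y where "Y i = L \<inter> R i - (\<Union>j<i. R j)" for i
  \<comment> \<open>For \<open>i \<le> n\<close> at least \<open>k\<close> points of
    \<open>L\<close> remain blocked, so the separation hypothesis applies.\<close>
  have tR: "t \<notin> R i" if "i \<le> n" for i
  proof
    assume "t \<in> R i"
    then obtain H where H: "H \<subseteq> L" "card H \<le> i" "t \<in> reach A s (L - H)" by (auto simp: R_def)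
    then have "card (L - H) = card L - card H"
      using assms(1) by (simp add: card_Diff_subset finite_subset)
    then have "k \<le> card (L - H)" using H(2) that assms(2) unfolding n_def by linarith
    then show False using sep[of "L - H"] H(3) by blast
  qed
  \<comment> \<open>A point \<open>x\<close> of \<open>L\<close> left on a walk blocked by
    \<open>Y i\<close> belongs to an earlier \<open>R j\<close>. Paying for \<open>x\<close> as well
    costs at most \<open>j + 1 \<le> i\<close>.\<close>
  have YR: "reach A s (Y i) \<subseteq> R i" for i
  proof
    fix x assume "x \<in> reach A s (Y i)"
    then show "x \<in> R i"
    proof (induction rule: reach_induct)
      case root
      show ?case unfolding R_def by (intro CollectI exI[of _ "{}"]) (simp add: reach_root)
    next
      case (step x y)
      show ?case
      proof (cases "x \<in> L")
        case False
        then show ?thesis using step.IH step.hyps(3) by (auto simp: R_def intro: reach_step)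
      next
        case True
        then obtain j where j: "j < i" "x \<in> R j" using step by (auto simp: Y_def)
        then obtain H where H: "H \<subseteq> L" "card H \<le> j" "x \<in> reach A s (L - H)" by (auto simp: R_def)
        have "x \<in> reach A s (L - insert x H)"
          using H(3) by (rule reach_mono[THEN subsetD, rotated 2]) auto
        then have "y \<in> reach A s (L - insert x H)" using step.hyps(3) by (auto intro: reach_step)
        moreover have "card (insert x H) \<le> i"
          using H(1,2) j(1) card_insert_le_m1[of i H x] by linarith
        ultimately show ?thesis using True H(1) unfolding R_def
          by (intro CollectI exI[of _ "insert x H"]) blast
      qed
    qed
  qed
  have sepY: "t \<notin> reach A s (Y i)" if "i \<le> n" for i using tR[OF that] YR by blast
  have finY: "finite (Y i)" for i using assms(1) by (simp add: Y_def)
  have pos: "card (Y i) \<ge> 1" if "i \<le> n" for i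
  proof -
    have "Y i \<noteq> {}" using sepY[OF that] assms(3) by metis
    then show ?thesis using finY[of i] by (simp add: Suc_le_eq card_gt_0_iff)
  qed
  have "x \<notin> Y j" if "i < j" "x \<in> Y i" for i j x using that by (auto simp: Y_def)
  then have disj: "Y i \<inter> Y j = {}" if "i \<noteq> j" for i j
    using that by (metis disjoint_iff linorder_neq_iff)
  have cardU: "(\<Sum>i\<in>I. card (Y i)) = card (\<Union>i\<in>I. Y i)" if "finite I" for I
    using that finY disj by (intro card_UN_disjoint[symmetric]) auto
  define I where "I = {i \<in> {..n}. card (Y i) = 1}"
  have "finite I" by (simp add: I_def)
  have "card I = (\<Sum>i\<in>I. card (Y i))" by (simp add: I_def)
  also have "\<dots> = card (\<Union>i\<in>I. Y i)" using cardU[OF \<open>finite I\<close>] .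
  also have "\<dots> \<le> card {v \<in> L. t \<notin> reach A s {v}}"
  proof (intro card_mono)
    show "(\<Union>i\<in>I. Y i) \<subseteq> {v \<in> L. t \<notin> reach A s {v}}"
    proof
      fix v assume "v \<in> (\<Union>i\<in>I. Y i)"
      then obtain i where i: "i \<le> n" "card (Y i) = 1" "v \<in> Y i" by (auto simp: I_def)
      then have "Y i = {v}" by (metis card_1_singletonE singletonD)
      then show "v \<in> {v \<in> L. t \<notin> reach A s {v}}" using sepY[OF i(1)] by (auto simp: Y_def)
    qed
  qed (use assms(1) in simp)
  finally have cI: "card I \<le> card {v \<in> L. t \<notin> reach A s {v}}" .
  \<comment> \<open>Each of the \<open>n + 1\<close> levels is nonempty, and those of size one are
    topped up by the indicator of \<open>I\<close>.\<close>
  have "(\<Sum>i\<le>n. 2) \<le> (\<Sum>i\<le>n. card (Y i) + (if i \<in> I then 1 else 0))"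
  proof (intro sum_mono)
    fix i assume "i \<in> {..n}"
    then show "2 \<le> card (Y i) + (if i \<in> I then 1 else 0)"
      using pos[of i] by (auto simp: I_def)
  qed
  also have "\<dots> = (\<Sum>i\<le>n. card (Y i)) + card I"
  proof -
    have "{..n} \<inter> I = I" by (auto simp: I_def)
    then show ?thesis by (simp add: sum.distrib sum.If_cases)
  qed
  also have "(\<Sum>i\<le>n. card (Y i)) \<le> card L"
    unfolding cardU[OF finite_atMost] by (intro card_mono) (auto simp: assms(1) Y_def)
  finally have "2 * (n + 1) \<le> card L + card I" by simp
  then show ?thesis using cI assms(2) by (simp add: n_def)
qed

text \<open>The elements of M are successive gates on the way from s. Between two of them lies the vertex
  b v, which need not be passed in order to reach the next gate v.\<close>

lemma bypassed_vertices:
  assumes "finite M"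
    and b: "\<And>v. v \<in> M \<Longrightarrow> b v \<in> reach A s {v}" "\<And>v. v \<in> M \<Longrightarrow> v \<in> reach A s {b v}"
      "\<And>v. v \<in> M \<Longrightarrow> b v \<notin> M"
    and lin: "\<And>v w. v \<in> M \<Longrightarrow> w \<in> M \<Longrightarrow> v \<noteq> w \<Longrightarrow> v \<notin> reach A s {w} \<or> w \<notin> reach A s {v}"
    and later: "\<And>v w. v \<in> M \<Longrightarrow> w \<in> M \<Longrightarrow> v \<notin> reach A s {w} \<Longrightarrow> b v \<notin> reach A s {w}"
  shows "inj_on b M" and "b ` M \<subseteq> reach A s (b ` M)"
proof -
  show "inj_on b M"
  proof (rule inj_onI, rule ccontr)
    \<comment> \<open>If, say, \<open>w\<close> comes before \<open>v\<close>, then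
      \<open>b v\<close> is cut off by blocking \<open>w\<close>, whereas \<open>b w\<close> is
      not.\<close>
    fix v w assume *: "v \<in> M" "w \<in> M" "b v = b w" "v \<noteq> w"
    from lin[OF *(1,2,4)] show False
      using later[OF *(1,2)] later[OF *(2,1)] b(1)[OF *(1)] b(1)[OF *(2)] *(3) by auto
  qed
  have refl: "v \<in> reach A s {v}" if "v \<in> M" for v
    using reach_insert_self[of v A s "{}"] b(2)[OF that] reach_mono[of A A "{}" "{b v}" s] by auto
  \<comment> \<open>\<open>D v\<close> is the set of gates before \<open>v\<close>. It shrinks
    strictly on passing to one of these gates, which drives the induction.\<close>
  define D where "D v = {w \<in> M. v \<notin> reach A s {w}}" for v
  have "v \<in> reach A s (b ` M) \<and> b v \<in> reach A s (b ` M)" if "v \<in> M" for v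
    using that
  proof (induction "card (D v)" arbitrary: v rule: less_induct)
    case less
    note v = \<open>v \<in> M\<close>
    have IH: "w \<in> reach A s (b ` M)" if "w \<in> D v" for w
    proof -
      have w: "w \<in> M" "v \<notin> reach A s {w}" using that by (auto simp: D_def)
      then have "reach A s {w} \<subseteq> reach A s {v}" using reach_avoiding_subset by metis
      have "D w \<subseteq> D v"
      proof
        fix z assume "z \<in> D w"
        then have z: "z \<in> M" "w \<notin> reach A s {z}" by (auto simp: D_def)
        then have "reach A s {z} \<subseteq> reach A s {w}" using reach_avoiding_subset by metis
        then show "z \<in> D v" using w z by (auto simp: D_def)
      qed
      moreover have "w \<notin> D w" using refl[OF w(1)] by (auto simp: D_def)
      ultimately have "D w \<subset> D v" using that by blast
      then have "card (D w) < card (D v)"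
        using assms(1) by (intro psubset_card_mono) (auto simp: D_def)
      then show ?thesis using less.hyps w(1) by blast
    qed
    \<comment> \<open>Take a walk that leaves neither \<open>v\<close> nor \<open>b v\<close>. Up to
      its exit through an earlier gate it lies in the second alternative; at such a gate
      \<open>w\<close> the induction hypothesis replaces the walk so far. Beyond that it meets no
      \<open>b z\<close>: for \<open>z\<close> before \<open>v\<close> this vertex lies in the
      second alternative, and for \<open>z\<close> after \<open>v\<close> it is cut off by blocking
      \<open>v\<close>.\<close>
    have key: "x \<in> reach A s (b ` M) \<or> (\<exists>w\<in>D v. x \<in> reach A s {w})"
      if "x \<in> reach A s {v, b v}" for x
      using that
    proof (induction rule: reach_induct)
      case (step x y)
      show ?case
      proof (cases "\<exists>w\<in>D v. x \<in> reach A s {w}")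
        case True
        then obtain w where w: "w \<in> D v" "x \<in> reach A s {w}" by blast
        show ?thesis
        proof (cases "x = w")
          case True
          have "w \<notin> b ` M" using w(1) b(3) by (auto simp: D_def)
          then show ?thesis using IH[OF w(1)] step.hyps(3) True by (auto intro: reach_step)
        next
          case False
          then show ?thesis using w step.hyps(3) by (auto intro: reach_step)
        qed
      next
        case False
        then have x: "x \<in> reach A s (b ` M)" using step.IH by blast
        have "x \<notin> b ` M"
        proof
          assume "x \<in> b ` M"
          then obtain z where z: "z \<in> M" "x = b z" by blast
          have "z \<noteq> v" using step.hyps(2) z by auto
          then consider "v \<notin> reach A s {z}" | "z \<notin> reach A s {v}" using lin[OF v z(1)] by blast
          then show False
          proof cases
            case 1
            then show False using False z b(1)[OF z(1)] by (auto simp: D_def)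
          next
            case 2
            then have "x \<notin> reach A s {v}" using later[OF z(1) v] z(2) by blast
            then show False using step.hyps(1) reach_mono[of A A "{v}" "{v, b v}" s] by blast
          qed
        qed
        then show ?thesis using x step.hyps(3) by (auto intro: reach_step)
      qed
    qed (simp add: reach_root)
    have "v \<in> reach A s {v, b v}" using reach_insert_self[OF b(2)[OF v]] .
    moreover have "b v \<in> reach A s {v, b v}"
      using reach_insert_self[OF b(1)[OF v]] by (simp add: insert_commute)
    moreover have "v \<notin> reach A s {w}" "b v \<notin> reach A s {w}" if "w \<in> D v" for w
      using that later[OF v] by (auto simp: D_def)
    ultimately show ?case using key by blast
  qed
  then show "b ` M \<subseteq> reach A s (b ` M)" by blast
qed

section \<open>Roots of out-branchings, and the choice of the leaves\<close>

text \<open>The path from the root to \<open>c\<close>, stopped at its first arrival, must end with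
  the only arc into \<open>c\<close>.\<close>

lemma rooted_tree_arc_reach:
  assumes T: "rooted_tree r W B" and "(a, c) \<in> B"
  shows "a \<in> reach B r {c}"
proof -
  note D = rooted_treeD[OF T]
  have "c \<in> W" "c \<noteq> r" using assms(2) D(3,5) by auto
  then have "c \<in> reach B r {c}"
    using reach_insert_self[of c B r "{}"] D(4) by (simp add: reach_empty)
  then have "c = r \<or> (\<exists>y\<in>reach B r {c}. (y, c) \<in> B)"
    by (rule reach_induct[where P = "\<lambda>x. x = r \<or> (\<exists>y\<in>reach B r {c}. (y, x) \<in> B)"]) auto
  then show ?thesis using \<open>c \<noteq> r\<close> assms(2) D(6) by metis
qed

lemma ell_attained:
  assumes "digraph V A"
  obtains W B where "out_tree V A W B" "card (leaves W B) = ell V A"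
proof -
  let ?S = "{card (leaves V' A') | V' A'. out_tree V A V' A'}"
  have fin: "finite V" and "V \<noteq> {}" and A: "A \<subseteq> V \<times> V" using assms by (auto simp: digraph_def)
  then obtain x where "x \<in> V" by blast
  then have "out_tree V A {x} {}"
    by (intro rooted_tree_imp_out_tree[of x]) (auto simp: rooted_tree_def)
  then have "?S \<noteq> {}" by blast
  moreover have "?S \<subseteq> {..card V}"
  proof
    fix m assume "m \<in> ?S"
    then obtain W B where "m = card (leaves W B)" "out_tree V A W B" by blast
    then show "m \<in> {..card V}"
      using card_mono[OF fin, of "leaves W B"] by (auto simp: out_tree_def leaves_def)
  qed
  then have "finite ?S" by (rule finite_subset) simp
  ultimately have "Max ?S \<in> ?S" by (rule Max_in[rotated])
  then show ?thesis using that by (auto simp: ell_def)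
qed

theorem theorem3:
  fixes V :: "'a set" and A :: "('a \<times> 'a) set" and k :: nat
  assumes "digraph V A"
    and "\<forall>a\<in>A. \<not> useless_arc V A a"
    and "k \<ge> 1"
    and "ell V A \<ge> 3 * k"
  shows "\<exists>A'. out_branching V A A' \<and> card (leaves V A') \<ge> k"
proof -
  have V: "finite V" "A \<subseteq> V \<times> V" using assms(1) by (auto simp: digraph_def)
  obtain W T where T: "out_tree V A W T" "card (leaves W T) = ell V A"
    using ell_attained[OF assms(1)] .
  have WV: "W \<subseteq> V" "T \<subseteq> A" using T(1) by (auto simp: out_tree_def)
  obtain t where rt: "rooted_tree t W T" using out_tree_imp_rooted_tree[OF T(1)] .
  note D = rooted_treeD[OF rt]
  define L where "L = leaves W T"
  have L: "finite L" "L = {v \<in> W. \<forall>w. (v, w) \<notin> T}" "3 * k \<le> card L"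
    using leaves_eq[OF D(1,3)] D(1) T(2) assms(4) by (auto simp: L_def)
  have "t \<notin> L"
  proof
    assume "t \<in> L"
    then have "W \<subseteq> {t}" using D(4) L(2) by (auto elim: converse_rtranclE)
    then have "card L \<le> 1" using L(2) card_mono[of "{t}" L] by auto
    then show False using L(3) assms(3) by simp
  qed
  \<comment> \<open>\<open>C\<close> consists of the possible roots of out-branchings.\<close>
  define C where "C = {x \<in> V. V \<subseteq> reach A x {}}"
  have useful: "\<exists>c\<in>C. a \<in> reach A c {b}" if ab: "(a, b) \<in> A" for a b
  proof -
    obtain B where B: "out_branching V A B" "(a, b) \<in> B"
      using assms(2) ab unfolding useless_arc_def by blast
    then have ot: "out_tree V A V B" by (simp add: out_branching_def)
    then obtain c where c: "rooted_tree c V B" by (rule out_tree_imp_rooted_tree)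
    have "B \<subseteq> A" using ot by (simp add: out_tree_def)
    then have sub: "reach B c S \<subseteq> reach A c S" for S by (rule reach_mono) simp
    have "V \<subseteq> reach B c {}" using rooted_treeD(4)[OF c] by (auto simp: reach_empty)
    then have "c \<in> C" using sub rooted_treeD(2)[OF c] unfolding C_def by blast
    then show ?thesis using rooted_tree_arc_reach[OF c B(2)] sub by blast
  qed
  have C_closed: "x \<in> C" if "c \<in> C" "c \<in> reach A x {}" "x \<in> V" for x c
    using that by (auto simp: C_def intro: reach_trans)
  \<comment> \<open>Follow a walk to \<open>t\<close> from a member of \<open>C\<close> and restart
    at each member of \<open>C\<close> that is left; the last restart is \<open>s\<close>.\<close>
  obtain s where s: "s \<in> C" "t \<in> reach A s (C - {s})"
  proof -
    have "L \<noteq> {}" using L(3) assms(3) by auto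
    then obtain v where "v \<in> W" "v \<noteq> t" using \<open>t \<notin> L\<close> L(2) by auto
    then obtain u where "(u, v) \<in> A" using rooted_tree_parent[OF rt] WV(2) by blast
    then obtain c where c: "c \<in> C" using useful by blast
    then have "t \<in> reach A c {}" using D(2) WV(1) by (auto simp: C_def)
    then have "\<exists>s\<in>C. t \<in> reach A s (C - {s})"
    proof (induction rule: reach_induct)
      case root
      then show ?case using c reach_root by metis
    next
      case (step x y)
      then show ?case
        by (cases "x \<in> C") (metis Diff_iff insertI1 reach_root reach_step)+
    qed
    then show ?thesis using that by blast
  qed
  have sV: "s \<in> V" "V \<subseteq> reach A s {}" using s(1) by (auto simp: C_def)
  \<comment> \<open>Predecessors of members of \<open>C\<close> are again in \<open>C\<close>, so a
    walk from \<open>s\<close> to \<open>c\<close> stays in \<open>C\<close> and never leaves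
    \<open>v\<close>.\<close>
  have C_reach: "c \<in> reach A s {v}" if "c \<in> C" "v \<notin> C" for c v
  proof -
    have "c \<in> reach A s {}" using that(1) sV(2) by (auto simp: C_def)
    then have "c \<in> C \<longrightarrow> c \<in> reach A s {v}"
    proof (induction rule: reach_induct)
      case (step x y)
      have "x \<in> C" if "y \<in> C"
        using that step.hyps(3) V(2) by (intro C_closed[of y x]) (auto intro: reach_root reach_step)
      then show ?case using step \<open>v \<notin> C\<close> by (auto intro: reach_step)
    qed (simp add: reach_root)
    then show ?thesis using that(1) by blast
  qed
  have useful_s: "a \<in> reach A s {b}" if "(a, b) \<in> A" "b \<notin> C" for a b
    using useful[OF that(1)] C_reach[OF _ that(2)] reach_trans by metis
  \<comment> \<open>Leaves have no outgoing tree arc, so blocking some of them does not interrupt a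
    tree path.\<close>
  have T_reach: "y \<in> reach A s S" if "x \<in> reach A s S" "(x, y) \<in> T\<^sup>*" "S \<subseteq> L" for x y S
    using that(2,1)
  proof (induction rule: rtrancl_induct)
    case (step y z)
    have "y \<notin> S" using step.hyps(2) that(3) L(2) by auto
    then show ?case using step WV(2) by (auto intro: reach_step)
  qed
  show ?thesis
  proof (cases "\<exists>S\<subseteq>L. k \<le> card S \<and> t \<in> reach A s S")
    case True
    then obtain S where S: "S \<subseteq> L" "k \<le> card S" "t \<in> reach A s S" by blast
    \<comment> \<open>If \<open>s\<close> were blocked, it would be the only vertex reached, which
      would make \<open>t = s\<close> a leaf.\<close>
    have "s \<notin> S"
    proof
      assume "s \<in> S"
      have "x = s" if "x \<in> reach A s S" for x
        using that by (induction rule: reach_induct) (use \<open>s \<in> S\<close> in auto)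
      then show False using S \<open>s \<in> S\<close> \<open>t \<notin> L\<close> by auto
    qed
    moreover have "S \<subseteq> reach A s S"
      using T_reach[OF S(3) _ S(1)] D(4) S(1) L(2) by blast
    ultimately show ?thesis
      using out_branching_with_leaves[OF V sV] S(2) le_trans by metis
  next
    case False
    define M0 where "M0 = {v \<in> L. t \<notin> reach A s {v}}"
    have "t \<in> reach A s {}" using sV(2) D(2) WV(1) by blast
    then have "card L + 2 \<le> card M0 + 2 * k"
      unfolding M0_def using False L(1,3) by (intro card_dominators) auto
    \<comment> \<open>The surplus of 2 allows for discarding \<open>s\<close> and later one more
      dominator \<open>z\<close>.\<close>
    then have card_M0: "k + 2 \<le> card M0" using L(3) by simp
    define M1 where "M1 = M0 - {s}"
    have fin: "finite M0" "finite M1" using L(1) by (auto simp: M0_def M1_def)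
    have card_M1: "k + 1 \<le> card M1"
      using card_M0 fin unfolding M1_def by (simp add: card_Diff_singleton_if) arith
    \<comment> \<open>By the choice of \<open>s\<close>, \<open>t\<close> is reached even with all
      of \<open>C - {s}\<close> blocked.\<close>
    have M1C: "v \<notin> C" if "v \<in> M1" for v
    proof
      assume "v \<in> C"
      then have "t \<in> reach A s {v}"
        using s(2) that reach_mono[of A A "{v}" "C - {s}" s] by (auto simp: M1_def)
      then show False using that by (auto simp: M1_def M0_def)
    qed
    have M1L: "v \<in> L" "t \<notin> reach A s {v}" if "v \<in> M1" for v
      using that by (auto simp: M1_def M0_def)
    have lin: "v \<notin> reach A s {w} \<or> w \<notin> reach A s {v}" if "v \<in> M1" "w \<in> M1" "v \<noteq> w" for v w
      using dominators_linear[OF that(3) \<open>t \<in> reach A s {}\<close>] M1L that by blast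
    \<comment> \<open>The arc from the parent \<open>u\<close> to \<open>v\<close> is not useless,
      so \<open>u\<close> is reached without leaving \<open>v\<close>, while \<open>t\<close> is
      not. The tree path from \<open>t\<close> to \<open>u\<close> therefore enters
      \<open>reach A s {v}\<close> along some arc \<open>(a, b)\<close>.\<close>
    have "\<exists>a b u. (u, v) \<in> T \<and> (a, b) \<in> T \<and> (b, u) \<in> T\<^sup>* \<and> a \<notin> reach A s {v} \<and> b \<in> reach A s {v}"
      if v: "v \<in> M1" for v
    proof -
      have "v \<in> W" "v \<noteq> t" using M1L[OF v] L(2) \<open>t \<notin> L\<close> by auto
      then obtain u where u: "(u, v) \<in> T" "(t, u) \<in> T\<^sup>*" using rooted_tree_parent[OF rt] by blast
      then have "u \<in> reach A s {v}" using useful_s M1C[OF v] WV(2) by blast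
      from rtrancl_crossing[OF u(2) M1L(2)[OF v] this]
      obtain a b where "(a, b) \<in> T" "(b, u) \<in> T\<^sup>*" "a \<notin> reach A s {v}" "b \<in> reach A s {v}" .
      then show ?thesis using u(1) by blast
    qed
    then obtain a b u where ab: "\<And>v. v \<in> M1 \<Longrightarrow> (u v, v) \<in> T" "\<And>v. v \<in> M1 \<Longrightarrow> (a v, b v) \<in> T"
      "\<And>v. v \<in> M1 \<Longrightarrow> (b v, u v) \<in> T\<^sup>*" "\<And>v. v \<in> M1 \<Longrightarrow> a v \<notin> reach A s {v}"
      "\<And>v. v \<in> M1 \<Longrightarrow> b v \<in> reach A s {v}"
      by metis
    \<comment> \<open>The tree path continues from \<open>b v\<close> to \<open>v\<close>, and the
      blocked leaf \<open>w\<close> cannot interrupt it.\<close>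
    have later: "b v \<notin> reach A s {w}" if "v \<in> M1" "w \<in> M1" "v \<notin> reach A s {w}" for v w
    proof
      assume "b v \<in> reach A s {w}"
      then have "v \<in> reach A s {w}"
        using T_reach[of "b v" "{w}" v] ab(1,3)[OF that(1)] M1L(1)[OF that(2)]
        by (auto intro: rtrancl_into_rtrancl)
      then show False using that(3) by blast
    qed
    have bL: "b v \<notin> L" if "v \<in> M1" for v
      using ab(1,3)[OF that] L(2) by (metis (mono_tags, lifting) converse_rtranclE mem_Collect_eq)
    \<comment> \<open>Of two such dominators one, say \<open>w\<close>, comes before the other,
      \<open>v\<close>. Then blocking \<open>w\<close> cuts off \<open>b v\<close>, which is
      impossible for a member of \<open>C\<close>.\<close>
    have "\<exists>z. \<forall>v\<in>M1. b v \<in> C \<longrightarrow> v = z"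
    proof (rule ccontr)
      assume "\<not> ?thesis"
      then obtain v w where vw: "v \<in> M1" "b v \<in> C" "w \<in> M1" "b w \<in> C" "v \<noteq> w" by metis
      then show False
        using lin[OF vw(1,3,5)] later[OF vw(1,3)] later[OF vw(3,1)] C_reach M1C by blast
    qed
    then obtain z where z: "\<And>v. v \<in> M1 \<Longrightarrow> b v \<in> C \<Longrightarrow> v = z" by blast
    define M where "M = M1 - {z}"
    have MM: "M \<subseteq> M1" "finite M" using fin by (auto simp: M_def)
    have card_M: "k \<le> card M"
      using card_M1 fin unfolding M_def by (simp add: card_Diff_singleton_if) arith
    have bC: "b v \<notin> C" if "v \<in> M" for v using that z by (auto simp: M_def)
    \<comment> \<open>As \<open>(a v, b v)\<close> is not useless, \<open>a v\<close> is reached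
      without leaving \<open>b v\<close>. It is not reached without leaving \<open>v\<close>, so
      that walk passes \<open>v\<close>.\<close>
    have vb: "v \<in> reach A s {b v}" if v: "v \<in> M" for v
    proof -
      have "v \<in> M1" using v MM by blast
      have "x \<in> reach A s {v} \<or> v \<in> reach A s {b v}" if "x \<in> reach A s {b v}" for x
        using that by (induction rule: reach_induct) (auto intro: reach_root reach_step)
      then show ?thesis
        using useful_s[of "a v" "b v"] bC[OF v] ab(2,4)[OF \<open>v \<in> M1\<close>] WV(2) by blast
    qed
    have inM1: "v \<in> M1" if "v \<in> M" for v using that MM by blast
    have bM: "b v \<notin> M" if "v \<in> M" for v using bL[OF inM1[OF that]] M1L(1) inM1 by blast
    note bp = bypassed_vertices[of M b A s, OF MM(2) ab(5)[OF inM1] vb bM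
      lin[OF inM1 inM1] later[OF inM1 inM1]]
    have "s \<notin> b ` M" using bC s(1) by auto
    from out_branching_with_leaves[OF V sV this bp(2)] show ?thesis
      using card_image[OF bp(1)] card_M by auto
  qed
qed

end
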